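(* Let $a(z)=\sum_{i\in\mathbb Z}a_iz^i$ be such that $a(z),a'(z)\in\mathcal W$. Define $$E_i=T(a)^i-T(a^i)\quad(i\ge0),\qquad F_k=\sum_{i=0}^k\frac1{i!}E_i,\qquad F=\lim_{k\to\infty}F_k.$$ Then $$\|E_i\|_{\mathcal F}\le\frac{i(i-1)}2\,\|a'\|_{\mathcal W}^2\,\|a\|_{\mathcal W}^{i-2}\quad\text{for all } i\ge0,$$ and $$\|F\|_{\mathcal F}\le\frac12\,\|a'\|_{\mathcal W}^2\,\exp(\|a\|_{\mathcal W}).$$
   Context: $\mathbb Z^+$ is the set of positive integers. $\mathcal W$ is the Wiener algebra of complex Laurent series $a(z)=\sum_{i\in\mathbb Z}a_iz^i$ on the unit circle $|z|=1$ with $\|a\|_{\mathcal W}=\sum_{i\in\mathbb Z}|a_i|<\infty$; it is a Banach algebra, so $a^i\in\mathcal W$ and $\exp(a)=\sum_{i\ge0}\frac1{i!}a^i\in\mathcal W$. The derivative is $a'(z)=\sum_{i\in\mathbb Z}ia_iz^{i-1}$, so $\|a'\|_{\mathcal W}=\sum_{i\in\mathbb Z}|ia_i|$. For $a\in\mathcal W$, $T(a)=(t_{i,j})_{i,j\in\mathbb Z^+}$ is the semi-infinite Toeplitz matrix with $t_{i,j}=a_{j-i}$. For a semi-infinite complex matrix $S=(s_{i,j})_{i,j\in\mathbb Z^+}$, $\|S\|_{\mathcal F}=\sum_{i,j\in\mathbb Z^+}|s_{i,j}|$. Semi-infinite matrices are regarded as linear operators on $\ell^p=\ell^p(\mathbb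 Z^+)$, $1\le p\le\infty$; $T(a)^0$ is the identity. Since $T(a)$ is bounded on $\ell^p$, $\exp(T(a))=\sum_{i\ge0}\frac1{i!}T(a)^i$ is well defined there. The limit defining $F$ is taken in the $\ell^p$ operator norm; it exists and equals $F=\exp(T(a))-T(\exp(a))$. Conventions: $0^0=1$; for $i\in\{0,1\}$ the right-hand side of the bound on $\|E_i\|_{\mathcal F}$ is read as $0$, even when $\|a\|_{\mathcal W}=0$. *)

theory Defs
  imports "HOL-Analysis.Analysis"
begin

text \<open>
  A Laurent series \<open>a(z) = \<Sum>i. a\<^sub>i z\<^sup>i\<close> is given by its coefficient family
  \<open>a :: int \<Rightarrow> complex\<close>; products of Laurent series are then Cauchy products.
\<close>

definition wiener :: "(int \<Rightarrow> complex) set" where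
  "wiener = {a. (\<lambda>i. cmod (a i)) summable_on UNIV}"

definition wiener_norm :: "(int \<Rightarrow> complex) \<Rightarrow> real" where
  "wiener_norm a = (\<Sum>\<^sub>\<infinity>i. cmod (a i))"

text \<open>The coefficient of \<open>z\<^sup>i\<close> in \<open>\<Sum>k. k a\<^sub>k z\<^bsup>k-1\<^esup>\<close> comes from \<open>k = i + 1\<close>.\<close>

definition laurent_deriv :: "(int \<Rightarrow> complex) \<Rightarrow> int \<Rightarrow> complex" where
  "laurent_deriv a i = of_int (i + 1) * a (i + 1)"

definition laurent_one :: "int \<Rightarrow> complex" where
  "laurent_one i = (if i = 0 then 1 else 0)"

definition laurent_mult :: "(int \<Rightarrow> complex) \<Rightarrow> (int \<Rightarrow> complex) \<Rightarrow> int \<Rightarrow> complex" where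
  "laurent_mult a b n = (\<Sum>\<^sub>\<infinity>k. a k * b (n - k))"

primrec laurent_power :: "(int \<Rightarrow> complex) \<Rightarrow> nat \<Rightarrow> int \<Rightarrow> complex" where
  "laurent_power a 0 = laurent_one"
| "laurent_power a (Suc n) = laurent_mult a (laurent_power a n)"

text \<open>
  Semi-infinite matrices and vectors are indexed from \<open>0\<close> instead of from \<open>1\<close>: \<open>S i j\<close> is the
  entry in row \<open>i + 1\<close> and column \<open>j + 1\<close>.  The shift leaves \<open>j - i\<close> unchanged.
\<close>

type_synonym cvec = "nat \<Rightarrow> complex"
type_synonym cmat = "nat \<Rightarrow> nat \<Rightarrow> complex"

definition toeplitz :: "(int \<Rightarrow> complex) \<Rightarrow> cmat" where
  "toeplitz a i j = a (int j - int i)"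

definition cmat_one :: cmat where
  "cmat_one i j = (if i = j then 1 else 0)"

definition cmat_diff :: "cmat \<Rightarrow> cmat \<Rightarrow> cmat" where
  "cmat_diff A B i j = A i j - B i j"

definition cmat_mult :: "cmat \<Rightarrow> cmat \<Rightarrow> cmat" where
  "cmat_mult A B i j = (\<Sum>\<^sub>\<infinity>k. A i k * B k j)"

primrec cmat_power :: "cmat \<Rightarrow> nat \<Rightarrow> cmat" where
  "cmat_power A 0 = cmat_one"
| "cmat_power A (Suc n) = cmat_mult A (cmat_power A n)"

definition cmat_vec :: "cmat \<Rightarrow> cvec \<Rightarrow> cvec" where
  "cmat_vec A x i = (\<Sum>\<^sub>\<infinity>j. A i j * x j)"

text \<open>The sum of the moduli of all entries; it may be infinite.\<close>

definition norm_F :: "cmat \<Rightarrow> ennreal" where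
  "norm_F S = (\<Sum>\<^sub>\<infinity>(i, j). ennreal (cmod (S i j)))"

text \<open>The spaces \<open>\<ell>\<^sup>p\<close>, meant for \<open>1 \<le> p \<le> \<infinity>\<close>.\<close>

definition lp_space :: "ereal \<Rightarrow> cvec set" where
  "lp_space p = (if p = \<infinity> then {x. bounded (range x)}
     else {x. (\<lambda>i. cmod (x i) powr real_of_ereal p) summable_on UNIV})"

definition lp_norm :: "ereal \<Rightarrow> cvec \<Rightarrow> real" where
  "lp_norm p x = (if p = \<infinity> then (SUP i. cmod (x i))
     else (\<Sum>\<^sub>\<infinity>i. cmod (x i) powr real_of_ereal p) powr (1 / real_of_ereal p))"

text \<open>
  The matrix \<open>A\<close> acts as a bounded linear operator on \<open>\<ell>\<^sup>p\<close>.  Summability of the row series is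
  required explicitly, because a divergent infinite sum silently evaluates to \<open>0\<close>.
\<close>

definition lp_bounded :: "ereal \<Rightarrow> cmat \<Rightarrow> bool" where
  "lp_bounded p A \<longleftrightarrow>
     (\<forall>x\<in>lp_space p. (\<forall>i. (\<lambda>j. A i j * x j) summable_on UNIV) \<and> cmat_vec A x \<in> lp_space p) \<and>
     (\<exists>C. \<forall>x\<in>lp_space p. lp_norm p (cmat_vec A x) \<le> C * lp_norm p x)"

text \<open>Meaningful only for matrices satisfying \<^const>\<open>lp_bounded\<close>.\<close>

definition lp_opnorm :: "ereal \<Rightarrow> cmat \<Rightarrow> real" where
  "lp_opnorm p A = (SUP x\<in>{x\<in>lp_space p. lp_norm p x \<le> 1}. lp_norm p (cmat_vec A x))"

definition lp_op_tendsto :: "ereal \<Rightarrow> (nat \<Rightarrow> cmat) \<Rightarrow> cmat \<Rightarrow> bool" where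
  "lp_op_tendsto p X A \<longleftrightarrow>
     (\<forall>k. lp_bounded p (X k)) \<and> lp_bounded p A \<and>
     (\<lambda>k. lp_opnorm p (cmat_diff (X k) A)) \<longlonglongrightarrow> 0"

definition E_mat :: "(int \<Rightarrow> complex) \<Rightarrow> nat \<Rightarrow> cmat" where
  "E_mat a i = cmat_diff (cmat_power (toeplitz a) i) (toeplitz (laurent_power a i))"

definition F_mat :: "(int \<Rightarrow> complex) \<Rightarrow> nat \<Rightarrow> cmat" where
  "F_mat a k r s = (\<Sum>i\<le>k. 1 / fact i * E_mat a i r s)"

end

theory Submission
  imports Defs
begin

text \<open>
  Since \<open>T(b) T(c) - T(bc)\<close> is minus a product of two Hankel matrices, its \<open>\<F>\<close>-norm is at most
  \<open>\<parallel>b'\<parallel> \<parallel>c'\<parallel>\<close>.  The recursion \<open>E\<^bsub>n+1\<^esub> = T(a) E\<^sub>n + (T(a) T(a\<^sup>n) - T(a\<cdot>a\<^sup>n))\<close> and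
  \<open>\<parallel>(a\<^sup>n)'\<parallel> \<le> n \<parallel>a'\<parallel> \<parallel>a\<parallel>\<^bsup>n-1\<^esup>\<close> give the bound on \<open>E\<^sub>n\<close>.  These bounds divided by \<open>n!\<close> have
  a finite sum, so \<open>F\<^sub>k\<close> converges in the \<open>\<F>\<close>-norm, which dominates every \<open>\<ell>\<^sup>p\<close> operator norm:
  no interpolation between the spaces \<open>\<ell>\<^sup>p\<close> is needed.  Limits are unique because
  operator-norm convergence implies convergence of the entries.
\<close>

subsection \<open>Absolutely summable families as integrals\<close>

text \<open>The l1 norm with values in \<open>ennreal\<close>. It is infinite for families that are
  not absolutely summable, where a real infinite sum would evaluate to 0; so sums can be estimated
  and exchanged before their convergence is known.\<close>

definition mass :: "('a \<Rightarrow> complex) \<Rightarrow> ennreal" where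
  "mass f = (\<integral>\<^sup>+x. ennreal (cmod (f x)) \<partial>count_space UNIV)"

text \<open>Bridge from \<open>norm_F\<close>, an infinite sum, to integrals, for which Tonelli is
  at hand. An enumeration of the infinite countable type carries both to series over the
  naturals.\<close>

lemma infsum_eq_nn_integral:
  fixes f :: "'a::countable \<Rightarrow> ennreal"
  assumes "infinite (UNIV :: 'a set)"
  shows "infsum f UNIV = (\<integral>\<^sup>+x. f x \<partial>count_space UNIV)"
proof -
  let ?g = "from_nat_into (UNIV :: 'a set)"
  have bij: "bij_betw ?g UNIV UNIV"
    using assms by (intro bij_betw_from_nat_into) auto
  have "((\<lambda>n. f (?g n)) has_sum infsum (\<lambda>n. f (?g n)) UNIV) UNIV"
    by (intro has_sum_infsum nonneg_summable_on_complete) simp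
  then have "(\<lambda>n. f (?g n)) sums infsum (\<lambda>n. f (?g n)) UNIV"
    by (rule has_sum_imp_sums)
  then have "infsum (\<lambda>n. f (?g n)) UNIV = (\<Sum>n. f (?g n))"
    by (simp add: sums_unique)
  also have "\<dots> = (\<integral>\<^sup>+n. f (?g n) \<partial>count_space UNIV)"
    by (simp add: nn_integral_count_space_nat)
  finally show ?thesis
    by (simp add: infsum_reindex_bij_betw[OF bij] nn_integral_bij_count_space[OF bij])
qed

lemma ennreal_infsum:
  fixes f :: "'a \<Rightarrow> real"
  assumes "f summable_on UNIV" and "\<And>x. 0 \<le> f x"
  shows "ennreal (infsum f UNIV) = infsum (\<lambda>x. ennreal (f x)) UNIV"
  using assms by (simp add: infsum_nonneg_is_SUPREMUM_ennreal nonneg_infsum_complete sum_ennreal)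

lemma abs_summable_iff_mass:
  "(\<lambda>x. cmod (f x)) summable_on UNIV \<longleftrightarrow> mass f < \<infinity>"
  using abs_summable_equivalent[of f UNIV]
  by (simp add: Infinite_Set_Sum.abs_summable_on_def integrable_iff_bounded mass_def)

lemma mass_eq_infsum:
  fixes f :: "'a::countable \<Rightarrow> complex"
  assumes "infinite (UNIV :: 'a set)" and "(\<lambda>x. cmod (f x)) summable_on UNIV"
  shows "mass f = ennreal (\<Sum>\<^sub>\<infinity>x. cmod (f x))"
  using assms by (simp add: ennreal_infsum mass_def infsum_eq_nn_integral)

text \<open>For finite mass this is the triangle inequality; for infinite mass it is trivial.
  Divergent sums, which evaluate to 0, are therefore covered.\<close>

lemma cmod_infsum_le_mass:
  fixes f :: "'a::countable \<Rightarrow> complex"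
  assumes "infinite (UNIV :: 'a set)"
  shows "ennreal (cmod (infsum f UNIV)) \<le> mass f"
proof (cases "mass f < \<infinity>")
  case True
  then have "(\<lambda>x. cmod (f x)) summable_on UNIV"
    by (simp add: abs_summable_iff_mass)
  then show ?thesis
    using assms by (simp add: mass_eq_infsum ennreal_leI norm_infsum_bound)
qed (simp add: less_top[symmetric])

text \<open>Tonelli: both sides equal the integral over the counting measure on pairs.\<close>

lemma nn_integral_count_space_swap:
  "(\<integral>\<^sup>+x. \<integral>\<^sup>+y. f x y \<partial>count_space UNIV \<partial>count_space UNIV) =
   (\<integral>\<^sup>+y. \<integral>\<^sup>+x. f x y \<partial>count_space UNIV \<partial>count_space UNIV)"
  using nn_integral_fst_count_space[of "\<lambda>(x, y). f x y"]
    nn_integral_snd_count_space[of "\<lambda>(x, y). f x y"] by simp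

text \<open>An injection reaches each index at most once, and the missed indices contribute
  nonnegative terms. Rows and columns of a Toeplitz matrix sample the coefficients in this
  way.\<close>

lemma nn_integral_inj_le:
  fixes f :: "'b \<Rightarrow> ennreal"
  assumes "inj h"
  shows "(\<integral>\<^sup>+x. f (h x) \<partial>count_space UNIV) \<le> (\<integral>\<^sup>+y. f y \<partial>count_space UNIV)"
proof -
  have "(\<integral>\<^sup>+x. f (h x) \<partial>count_space UNIV) = (\<integral>\<^sup>+y. f y \<partial>count_space (range h))"
    using assms by (intro nn_integral_bij_count_space) (simp add: bij_betw_def)
  also have "\<dots> = (\<integral>\<^sup>+y. f y * indicator (range h) y \<partial>count_space UNIV)"
    by (simp add: nn_integral_count_space_indicator)
  also have "\<dots> \<le> (\<integral>\<^sup>+y. f y \<partial>count_space UNIV)"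
    by (intro nn_integral_mono) (auto simp: indicator_def)
  finally show ?thesis .
qed

subsection \<open>The Wiener algebra\<close>

lemma wiener_iff_mass: "a \<in> wiener \<longleftrightarrow> mass a < \<infinity>"
  by (simp add: wiener_def abs_summable_iff_mass)

lemma wiener_norm_mass: "a \<in> wiener \<Longrightarrow> mass a = ennreal (wiener_norm a)"
  by (simp add: wiener_def wiener_norm_def mass_eq_infsum infinite_UNIV_int)

lemma wiener_norm_nonneg: "0 \<le> wiener_norm a"
  unfolding wiener_norm_def by (intro infsum_nonneg) simp

text \<open>The index shift in \<open>laurent_deriv\<close> is a bijection of the integers; from
  here on the derivative is handled as the unshifted weighting \<open>i * a i\<close>.\<close>

lemma mass_laurent_deriv: "mass (laurent_deriv a) = mass (\<lambda>i. of_int i * a i)"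
proof -
  have "bij_betw (\<lambda>i::int. i + 1) UNIV UNIV"
    by (rule bij_betwI[where g = "\<lambda>i. i - 1"]) auto
  from nn_integral_bij_count_space[OF this, of "\<lambda>i. ennreal (cmod (of_int i * a i))"]
  show ?thesis
    by (simp add: mass_def laurent_deriv_def)
qed

text \<open>After the exchange of sums, the inner sum over \<open>n\<close> is invariant under
  translation by \<open>k\<close>.\<close>

lemma nn_integral_convolution:
  fixes f g :: "int \<Rightarrow> ennreal"
  shows "(\<integral>\<^sup>+n. \<integral>\<^sup>+k. f k * g (n - k) \<partial>count_space UNIV \<partial>count_space UNIV) =
    (\<integral>\<^sup>+k. f k \<partial>count_space UNIV) * (\<integral>\<^sup>+k. g k \<partial>count_space UNIV)"
proof -
  have shift: "(\<integral>\<^sup>+n. g (n - k) \<partial>count_space UNIV) = (\<integral>\<^sup>+n. g n \<partial>count_space UNIV)" for k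
    by (rule nn_integral_bij_count_space, rule bij_betwI[where g = "\<lambda>i. i + k"]) auto
  show ?thesis
    by (subst nn_integral_count_space_swap) (simp add: nn_integral_cmult nn_integral_multc shift)
qed

lemma mass_laurent_mult: "mass (laurent_mult a b) \<le> mass a * mass b"
proof -
  have "mass (laurent_mult a b) \<le>
      (\<integral>\<^sup>+n. mass (\<lambda>k. a k * b (n - k)) \<partial>count_space UNIV)"
    unfolding mass_def[of "laurent_mult a b"] laurent_mult_def
    by (intro nn_integral_mono cmod_infsum_le_mass) (simp add: infinite_UNIV_int)
  also have "\<dots> = mass a * mass b"
    by (simp add: mass_def norm_mult ennreal_mult
        nn_integral_convolution[where f = "\<lambda>k. ennreal (cmod (a k))" and g = "\<lambda>k. ennreal (cmod (b k))"])
  finally show ?thesis .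
qed

text \<open>The Leibniz rule on coefficients: the weight \<open>n\<close> is split as
  \<open>k + (n - k)\<close>, one part for each factor.\<close>

lemma mass_laurent_deriv_mult:
  "mass (laurent_deriv (laurent_mult a b)) \<le>
     mass (laurent_deriv a) * mass b + mass a * mass (laurent_deriv b)"
proof -
  let ?da = "\<lambda>i. of_int i * a i" and ?db = "\<lambda>i. of_int i * b i"
  have pt: "ennreal (cmod (of_int n * laurent_mult a b n)) \<le>
     (\<integral>\<^sup>+k. ennreal (cmod (?da k)) * ennreal (cmod (b (n - k))) \<partial>count_space UNIV) +
     (\<integral>\<^sup>+k. ennreal (cmod (a k)) * ennreal (cmod (?db (n - k))) \<partial>count_space UNIV)" for n
  proof -
    have "of_int n * laurent_mult a b n = (\<Sum>\<^sub>\<infinity>k. of_int n * (a k * b (n - k)))"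
      by (simp add: laurent_mult_def infsum_cmult_right')
    then have "ennreal (cmod (of_int n * laurent_mult a b n)) \<le>
        mass (\<lambda>k. of_int n * (a k * b (n - k)))"
      by (simp only:) (intro cmod_infsum_le_mass, simp add: infinite_UNIV_int)
    also have "\<dots> \<le> (\<integral>\<^sup>+k. ennreal (cmod (?da k)) * ennreal (cmod (b (n - k))) +
        ennreal (cmod (a k)) * ennreal (cmod (?db (n - k))) \<partial>count_space UNIV)"
      unfolding mass_def
    proof (intro nn_integral_mono)
      fix k
      have "of_int n * (a k * b (n - k)) = ?da k * b (n - k) + a k * ?db (n - k)"
        by (simp add: algebra_simps)
      then have "cmod (of_int n * (a k * b (n - k))) \<le>
          cmod (?da k) * cmod (b (n - k)) + cmod (a k) * cmod (?db (n - k))"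
        by (metis norm_mult norm_triangle_ineq)
      then show "ennreal (cmod (of_int n * (a k * b (n - k)))) \<le>
          ennreal (cmod (?da k)) * ennreal (cmod (b (n - k))) +
          ennreal (cmod (a k)) * ennreal (cmod (?db (n - k)))"
        by (simp del: ennreal_plus add: ennreal_plus[symmetric] ennreal_mult[symmetric] ennreal_leI)
    qed
    finally show ?thesis
      by (simp add: nn_integral_add)
  qed
  have "mass (laurent_deriv (laurent_mult a b)) \<le>
     (\<integral>\<^sup>+n. (\<integral>\<^sup>+k. ennreal (cmod (?da k)) * ennreal (cmod (b (n - k))) \<partial>count_space UNIV) +
     (\<integral>\<^sup>+k. ennreal (cmod (a k)) * ennreal (cmod (?db (n - k))) \<partial>count_space UNIV) \<partial>count_space UNIV)"
    unfolding mass_laurent_deriv[of "laurent_mult a b"] mass_def[of "\<lambda>n. of_int n * laurent_mult a b n"]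
    by (intro nn_integral_mono pt)
  also have "\<dots> = mass ?da * mass b + mass a * mass ?db"
    by (subst nn_integral_add) (simp_all only: mass_def measurable_count_space_eq1
       nn_integral_convolution[where f = "\<lambda>k. ennreal (cmod (?da k))" and g = "\<lambda>k. ennreal (cmod (b k))"]
       nn_integral_convolution[where f = "\<lambda>k. ennreal (cmod (a k))" and g = "\<lambda>k. ennreal (cmod (?db k))"], simp_all)
  finally show ?thesis
    by (simp add: mass_laurent_deriv)
qed

lemma mass_laurent_one: "mass laurent_one = 1" "mass (laurent_deriv laurent_one) = 0"
proof -
  have "mass laurent_one = (\<integral>\<^sup>+i. indicator {0::int} i \<partial>count_space UNIV)"
    unfolding mass_def laurent_one_def by (intro nn_integral_cong) (auto simp: indicator_def)
  then show "mass laurent_one = 1"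
    by simp
  \<comment> \<open>The weight vanishes at the only index where \<open>laurent_one\<close> does
    not.\<close>
  have "of_int (i + 1) * laurent_one (i + 1) = 0" for i
    by (cases "i + 1 = 0") (simp_all only: laurent_one_def of_int_0 mult_zero_left mult_zero_right if_False)
  then have "laurent_deriv laurent_one = (\<lambda>i. 0)"
    by (simp only: fun_eq_iff laurent_deriv_def simp_thms)
  then show "mass (laurent_deriv laurent_one) = 0"
    by (simp add: mass_def)
qed

lemma mass_laurent_power:
  assumes "a \<in> wiener"
  shows "mass (laurent_power a n) \<le> ennreal (wiener_norm a ^ n)"
proof (induction n)
  case (Suc n)
  have "mass (laurent_power a (Suc n)) \<le> mass a * mass (laurent_power a n)"
    by (simp add: mass_laurent_mult)
  also have "\<dots> \<le> ennreal (wiener_norm a) * ennreal (wiener_norm a ^ n)"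
    using Suc by (intro mult_mono) (simp_all add: wiener_norm_mass assms)
  finally show ?case
    by (simp add: ennreal_mult wiener_norm_nonneg)
qed (simp add: mass_laurent_one)

lemma wiener_laurent_power: "a \<in> wiener \<Longrightarrow> laurent_power a n \<in> wiener"
  using mass_laurent_power[of a n] by (simp add: wiener_iff_mass order_le_less_trans)

lemma mass_laurent_deriv_power:
  assumes "a \<in> wiener" and "laurent_deriv a \<in> wiener"
  shows "mass (laurent_deriv (laurent_power a n)) \<le>
    ennreal (real n * wiener_norm (laurent_deriv a) * wiener_norm a ^ (n - 1))"
proof (induction n)
  case (Suc n)
  let ?N = "wiener_norm a" and ?D = "wiener_norm (laurent_deriv a)"
  have "mass (laurent_deriv (laurent_power a (Suc n))) \<le>
      mass (laurent_deriv a) * mass (laurent_power a n) +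
      mass a * mass (laurent_deriv (laurent_power a n))"
    by (simp add: mass_laurent_deriv_mult)
  also have "\<dots> \<le> ennreal ?D * ennreal (?N ^ n) + ennreal ?N * ennreal (real n * ?D * ?N ^ (n - 1))"
    using Suc by (intro add_mono mult_mono mass_laurent_power) (simp_all add: wiener_norm_mass assms)
  also have "\<dots> = ennreal (?D * ?N ^ n + ?N * (real n * ?D * ?N ^ (n - 1)))"
    by (simp add: ennreal_mult wiener_norm_nonneg)
  \<comment> \<open>At \<open>n = 0\<close> the truncated exponent \<open>n - 1\<close> is harmless
    because of the factor \<open>real n\<close>.\<close>
  also have "?D * ?N ^ n + ?N * (real n * ?D * ?N ^ (n - 1)) = real (Suc n) * ?D * ?N ^ (Suc n - 1)"
    by (cases n) (simp_all add: algebra_simps)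
  finally show ?case .
qed (simp add: mass_laurent_one)

subsection \<open>Entrywise norm and Toeplitz matrices\<close>

lemma norm_F_iterated:
  "norm_F S = (\<integral>\<^sup>+i. \<integral>\<^sup>+j. ennreal (cmod (S i j)) \<partial>count_space UNIV \<partial>count_space UNIV)"
proof -
  have "infinite (UNIV :: (nat \<times> nat) set)"
    by (simp add: finite_prod)
  then have "norm_F S = (\<integral>\<^sup>+x. (case x of (i, j) \<Rightarrow> ennreal (cmod (S i j))) \<partial>count_space UNIV)"
    by (simp add: norm_F_def infsum_eq_nn_integral)
  then show ?thesis
    by (simp add: nn_integral_fst_count_space[symmetric])
qed

lemma norm_F_add:
  assumes "\<And>i j. cmod (S i j) \<le> cmod (A i j) + cmod (B i j)"
  shows "norm_F S \<le> norm_F A + norm_F B"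
proof -
  have "norm_F S \<le> (\<integral>\<^sup>+i. \<integral>\<^sup>+j. ennreal (cmod (A i j)) + ennreal (cmod (B i j))
      \<partial>count_space UNIV \<partial>count_space UNIV)"
    unfolding norm_F_iterated using assms
    by (intro nn_integral_mono) (simp del: ennreal_plus add: ennreal_plus[symmetric] ennreal_leI)
  also have "\<dots> = norm_F A + norm_F B"
    by (simp add: norm_F_iterated nn_integral_add)
  finally show ?thesis .
qed

lemma entry_le_norm_F: "ennreal (cmod (S i j)) \<le> norm_F S"
proof -
  have "ennreal (cmod (S i j)) \<le> (\<integral>\<^sup>+j. ennreal (cmod (S i j)) \<partial>count_space UNIV)"
    by (rule nn_integral_ge_point) simp
  also have "\<dots> \<le> norm_F S"
    unfolding norm_F_iterated
    by (rule nn_integral_ge_point[where p = "\<lambda>i. \<integral>\<^sup>+j. ennreal (cmod (S i j)) \<partial>count_space UNIV"]) simp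
  finally show ?thesis .
qed

text \<open>Column \<open>k\<close> of T(a) lists coefficients of \<open>a\<close> at the distinct
  indices \<open>k - i\<close>, so its l1 norm is at most \<open>mass a\<close>. Summing over the
  row index \<open>i\<close> first isolates such a column.\<close>

lemma norm_F_toeplitz_mult: "norm_F (cmat_mult (toeplitz a) X) \<le> mass a * norm_F X"
proof -
  have "norm_F (cmat_mult (toeplitz a) X) \<le>
      (\<integral>\<^sup>+i. \<integral>\<^sup>+j. mass (\<lambda>k. toeplitz a i k * X k j) \<partial>count_space UNIV \<partial>count_space UNIV)"
    unfolding norm_F_iterated cmat_mult_def
    by (intro nn_integral_mono cmod_infsum_le_mass) simp
  also have "\<dots> = (\<integral>\<^sup>+j. \<integral>\<^sup>+i. \<integral>\<^sup>+k. ennreal (cmod (toeplitz a i k)) * ennreal (cmod (X k j))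
      \<partial>count_space UNIV \<partial>count_space UNIV \<partial>count_space UNIV)"
    by (subst nn_integral_count_space_swap) (simp add: mass_def norm_mult ennreal_mult)
  also have "\<dots> = (\<integral>\<^sup>+j. \<integral>\<^sup>+k. (\<integral>\<^sup>+i. ennreal (cmod (toeplitz a i k)) \<partial>count_space UNIV) *
      ennreal (cmod (X k j)) \<partial>count_space UNIV \<partial>count_space UNIV)"
    by (subst (2) nn_integral_count_space_swap) (simp add: nn_integral_multc)
  also have "\<dots> \<le> (\<integral>\<^sup>+j. \<integral>\<^sup>+k. mass a * ennreal (cmod (X k j)) \<partial>count_space UNIV \<partial>count_space UNIV)"
  proof (intro nn_integral_mono mult_right_mono)
    fix k :: nat
    have "inj (\<lambda>i. int k - int i)"
      by (simp add: inj_def)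
    then show "(\<integral>\<^sup>+i. ennreal (cmod (toeplitz a i k)) \<partial>count_space UNIV) \<le> mass a"
      unfolding mass_def toeplitz_def
      by (rule nn_integral_inj_le[where f = "\<lambda>i. ennreal (cmod (a i))"])
  qed simp
  also have "\<dots> = mass a * norm_F X"
    unfolding norm_F_iterated
    by (subst nn_integral_count_space_swap) (simp add: nn_integral_cmult)
  finally show ?thesis .
qed

text \<open>The value \<open>s = i + m\<close> comes from exactly \<open>s + 1\<close> pairs. This
  multiplicity is the weight that will turn coefficients of a series into those of its
  derivative.\<close>

lemma nn_integral_diagonals:
  fixes \<beta> :: "nat \<Rightarrow> ennreal"
  shows "(\<integral>\<^sup>+i. \<integral>\<^sup>+m. \<beta> (i + m) \<partial>count_space UNIV \<partial>count_space UNIV) \<le>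
    (\<integral>\<^sup>+s. of_nat (Suc s) * \<beta> s \<partial>count_space UNIV)"
proof -
  have "(\<integral>\<^sup>+m. \<beta> (i + m) \<partial>count_space UNIV) \<le> (\<integral>\<^sup>+s. indicator {..s} i * \<beta> s \<partial>count_space UNIV)"
    for i :: nat
    using nn_integral_inj_le[of "\<lambda>m. i + m" "\<lambda>s. indicator {..s} i * \<beta> s"]
    by (simp add: inj_def)
  then have "(\<integral>\<^sup>+i. \<integral>\<^sup>+m. \<beta> (i + m) \<partial>count_space UNIV \<partial>count_space UNIV) \<le>
      (\<integral>\<^sup>+i. \<integral>\<^sup>+s. indicator {..s} i * \<beta> s \<partial>count_space UNIV \<partial>count_space UNIV)"
    by (rule nn_integral_mono)
  also have "\<dots> = (\<integral>\<^sup>+s. of_nat (Suc s) * \<beta> s \<partial>count_space UNIV)"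
    by (subst nn_integral_count_space_swap) (simp add: nn_integral_multc)
  finally show ?thesis .
qed

lemma abs_summable_mult_bounded:
  fixes f g :: "'a \<Rightarrow> complex"
  assumes "(\<lambda>x. cmod (f x)) summable_on UNIV" and "\<And>x. cmod (g x) \<le> C"
  shows "(\<lambda>x. cmod (f x * g x)) summable_on UNIV"
proof (rule Infinite_Sum.abs_summable_on_comparison_test')
  show "(\<lambda>x. cmod (f x) * C) summable_on UNIV"
    using assms(1) by (rule summable_on_cmult_left)
qed (simp add: norm_mult assms mult_left_mono)

text \<open>The nonnegative half will be a matrix product; the negative half, enumerated by
  \<open>- int (Suc m)\<close>, will be the Hankel correction.\<close>

lemma infsum_int_split:
  fixes h :: "int \<Rightarrow> complex"
  assumes "(\<lambda>z. cmod (h z)) summable_on UNIV"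
  shows "infsum h UNIV = (\<Sum>\<^sub>\<infinity>k. h (int k)) + (\<Sum>\<^sub>\<infinity>m. h (- int (Suc m)))"
proof -
  have UN: "UNIV = range int \<union> range (\<lambda>m. - int (Suc m))"
  proof (intro set_eqI iffI UnCI)
    fix z :: int
    assume "z \<notin> range (\<lambda>m. - int (Suc m))"
    then show "z \<in> range int"
      by (cases z rule: int_cases) auto
  qed simp
  have sm: "h summable_on A" for A
    using assms abs_summable_summable summable_on_subset_banach by blast
  have "infsum h UNIV = infsum h (range int) + infsum h (range (\<lambda>m. - int (Suc m)))"
    by (subst UN, rule infsum_Un_disjoint) (auto intro: sm)
  also have "\<dots> = (\<Sum>\<^sub>\<infinity>k. h (int k)) + (\<Sum>\<^sub>\<infinity>m. h (- int (Suc m)))"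
    by (subst (1 2) infsum_reindex) (auto simp: inj_def o_def)
  finally show ?thesis .
qed

lemma wiener_bounded:
  assumes "c \<in> wiener"
  shows "cmod (c i) \<le> wiener_norm c"
proof -
  have "ennreal (cmod (c i)) \<le> mass c"
    unfolding mass_def by (rule nn_integral_ge_point) simp
  then show ?thesis
    using assms by (simp add: wiener_norm_mass wiener_norm_nonneg)
qed

text \<open>The difference is minus a product of two Hankel matrices, since the Cauchy product also runs
  over the negative indices that matrix multiplication omits.\<close>

lemma norm_F_toeplitz_defect:
  assumes "b \<in> wiener" and "c \<in> wiener"
  shows "norm_F (cmat_diff (cmat_mult (toeplitz b) (toeplitz c)) (toeplitz (laurent_mult b c))) \<le>
    mass (laurent_deriv b) * mass (laurent_deriv c)" (is "norm_F ?D \<le> _")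
proof -
  let ?b = "\<lambda>s. b (- int (Suc s))" and ?c = "\<lambda>m j. c (int j + int (Suc m))"
  \<comment> \<open>Substituting \<open>k - int i\<close> for the Cauchy index turns the coefficient
    at \<open>j - i\<close> into a sum of \<open>?h\<close> over all integers. Its nonnegative half
    cancels against the matrix product, and its negative half remains with a minus sign.\<close>
  have entry: "?D i j = - (\<Sum>\<^sub>\<infinity>m. ?b (i + m) * ?c m j)" for i j
  proof -
    let ?h = "\<lambda>k. b (k - int i) * c (int j - k)"
    have bij: "bij_betw (\<lambda>k. k - int i) UNIV UNIV"
      by (rule bij_betwI[where g = "\<lambda>k. k + int i"]) auto
    have shift: "(\<lambda>k. cmod (b (k - int i))) summable_on UNIV"
      using assms(1) summable_on_reindex_bij_betw[OF bij, of "\<lambda>k. cmod (b k)"]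
      by (simp add: wiener_def)
    have "laurent_mult b c (int j - int i) = infsum ?h UNIV"
      using infsum_reindex_bij_betw[OF bij, of "\<lambda>k. b k * c (int j - int i - k)"]
      by (simp add: laurent_mult_def)
    also have "\<dots> = (\<Sum>\<^sub>\<infinity>k. ?h (int k)) + (\<Sum>\<^sub>\<infinity>m. ?h (- int (Suc m)))"
      using abs_summable_mult_bounded[OF shift wiener_bounded[OF assms(2)]]
      by (rule infsum_int_split)
    finally show ?thesis
      by (simp add: cmat_diff_def cmat_mult_def toeplitz_def algebra_simps)
  qed
  \<comment> \<open>The weight \<open>j + m + 1\<close> is at least 1, so inserting it can only
    increase the sum. The resulting bound is uniform in \<open>m\<close>, which leaves a double sum
    over \<open>b\<close> alone.\<close>
  have col: "(\<integral>\<^sup>+j. ennreal (cmod (?c m j)) \<partial>count_space UNIV) \<le> mass (laurent_deriv c)" for m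
  proof -
    have "(\<integral>\<^sup>+j. ennreal (cmod (?c m j)) \<partial>count_space UNIV) \<le>
        (\<integral>\<^sup>+j. ennreal (cmod (of_int (int j + int (Suc m)) * ?c m j)) \<partial>count_space UNIV)"
    proof (intro nn_integral_mono ennreal_leI)
      fix j :: nat
      have "1 * cmod (?c m j) \<le> cmod (of_int (int j + int (Suc m))) * cmod (?c m j)"
        by (intro mult_right_mono) (simp_all only: norm_of_int, simp_all)
      then show "cmod (?c m j) \<le> cmod (of_int (int j + int (Suc m)) * ?c m j)"
        by (simp only: norm_mult mult_1)
    qed
    also have "\<dots> \<le> mass (laurent_deriv c)"
      unfolding mass_laurent_deriv[of c] mass_def[of "\<lambda>i. of_int i * c i"]
      by (rule nn_integral_inj_le[where h = "\<lambda>j. int j + int (Suc m)" and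
          f = "\<lambda>i. ennreal (cmod (of_int i * c i))"]) (simp add: inj_def)
    finally show ?thesis .
  qed
  have "norm_F ?D \<le> (\<integral>\<^sup>+i. \<integral>\<^sup>+j. mass (\<lambda>m. ?b (i + m) * ?c m j) \<partial>count_space UNIV \<partial>count_space UNIV)"
    unfolding norm_F_iterated entry norm_minus_cancel
    by (intro nn_integral_mono cmod_infsum_le_mass) simp
  also have "\<dots> = (\<integral>\<^sup>+i. \<integral>\<^sup>+m. ennreal (cmod (?b (i + m))) *
      (\<integral>\<^sup>+j. ennreal (cmod (?c m j)) \<partial>count_space UNIV) \<partial>count_space UNIV \<partial>count_space UNIV)"
    unfolding mass_def norm_mult ennreal_mult[OF norm_ge_zero norm_ge_zero]
    by (subst (2) nn_integral_count_space_swap) (simp add: nn_integral_cmult)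
  also have "\<dots> \<le> (\<integral>\<^sup>+i. \<integral>\<^sup>+m. ennreal (cmod (?b (i + m))) * mass (laurent_deriv c)
      \<partial>count_space UNIV \<partial>count_space UNIV)"
    by (intro nn_integral_mono mult_left_mono col) simp
  also have "\<dots> = (\<integral>\<^sup>+i. \<integral>\<^sup>+m. ennreal (cmod (?b (i + m))) \<partial>count_space UNIV \<partial>count_space UNIV) *
      mass (laurent_deriv c)"
    by (simp add: nn_integral_multc)
  also have "\<dots> \<le> (\<integral>\<^sup>+s. of_nat (Suc s) * ennreal (cmod (?b s)) \<partial>count_space UNIV) * mass (laurent_deriv c)"
    by (intro mult_right_mono nn_integral_diagonals[where \<beta> = "\<lambda>s. ennreal (cmod (?b s))"]) simp
  \<comment> \<open>The multiplicity \<open>Suc s\<close> is the modulus of the index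
    \<open>- int (Suc s)\<close>, so this is the sum over the negative indices in the mass of the
    derivative of \<open>b\<close>.\<close>
  also have "\<dots> = (\<integral>\<^sup>+s. ennreal (cmod (of_int (- int (Suc s)) * ?b s)) \<partial>count_space UNIV) *
      mass (laurent_deriv c)"
  proof -
    have "of_nat (Suc s) * ennreal (cmod (?b s)) = ennreal (cmod (of_int (- int (Suc s)) * ?b s))" for s
      by (simp only: norm_mult norm_of_int ennreal_mult[OF norm_ge_zero norm_ge_zero] ennreal_mult[OF abs_ge_zero norm_ge_zero])
        (simp add: ennreal_of_nat_eq_real_of_nat add.commute)
    then show ?thesis by simp
  qed
  also have "\<dots> \<le> mass (laurent_deriv b) * mass (laurent_deriv c)"
    unfolding mass_laurent_deriv[of b] mass_def[of "\<lambda>i. of_int i * b i"]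
    by (intro mult_right_mono nn_integral_inj_le[where h = "\<lambda>s. - int (Suc s)" and
          f = "\<lambda>i. ennreal (cmod (of_int i * b i))"]) (simp_all add: inj_def)
  finally show ?thesis .
qed

section \<open>The recursion for \<open>E_mat\<close> and the bound on its entrywise norm\<close>

lemma E_mat_Suc:
  assumes "a \<in> wiener" and "norm_F (E_mat a n) < \<infinity>"
  shows "E_mat a (Suc n) i j = cmat_mult (toeplitz a) (E_mat a n) i j +
    cmat_diff (cmat_mult (toeplitz a) (toeplitz (laurent_power a n)))
      (toeplitz (laurent_mult a (laurent_power a n))) i j"
proof -
  have "inj (\<lambda>k. int k - int i)"
    by (simp add: inj_def)
  then have "mass (toeplitz a i) \<le> mass a"
    unfolding mass_def toeplitz_def
    by (rule nn_integral_inj_le[where f = "\<lambda>i. ennreal (cmod (a i))"])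
  then have row: "(\<lambda>k. cmod (toeplitz a i k)) summable_on UNIV"
    using assms(1) by (simp add: abs_summable_iff_mass wiener_iff_mass order_le_less_trans)
  \<comment> \<open>A finite \<open>norm_F\<close> bounds all entries. Together with the absolutely
    summable row of \<open>toeplitz a\<close> this makes the product series converge, so that the
    sum below may be split.\<close>
  have "cmod (E_mat a n k j) \<le> enn2real (norm_F (E_mat a n))" for k
    using entry_le_norm_F[of "E_mat a n" k j] assms(2)
    by (metis enn2real_mono enn2real_ennreal infinity_ennreal_def norm_ge_zero)
  from abs_summable_mult_bounded[OF row this]
  have s1: "(\<lambda>k. toeplitz a i k * E_mat a n k j) summable_on UNIV"
    by (rule abs_summable_summable)
  have "cmod (toeplitz (laurent_power a n) k j) \<le> wiener_norm (laurent_power a n)" for k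
    by (simp add: toeplitz_def wiener_bounded wiener_laurent_power assms)
  from abs_summable_mult_bounded[OF row this]
  have s2: "(\<lambda>k. toeplitz a i k * toeplitz (laurent_power a n) k j) summable_on UNIV"
    by (rule abs_summable_summable)
  \<comment> \<open>The power \<open>n\<close> of T(a) is replaced by \<open>E_mat a n\<close> plus
    the Toeplitz matrix of \<open>laurent_power a n\<close>.\<close>
  have "cmat_power (toeplitz a) (Suc n) i j =
      (\<Sum>\<^sub>\<infinity>k. toeplitz a i k * E_mat a n k j + toeplitz a i k * toeplitz (laurent_power a n) k j)"
    by (simp add: cmat_mult_def E_mat_def cmat_diff_def algebra_simps)
  also have "\<dots> = cmat_mult (toeplitz a) (E_mat a n) i j +
      cmat_mult (toeplitz a) (toeplitz (laurent_power a n)) i j"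
    by (simp add: cmat_mult_def infsum_add s1 s2)
  finally show ?thesis
    by (simp add: E_mat_def cmat_diff_def)
qed

lemma norm_F_E_mat:
  assumes "a \<in> wiener" and "laurent_deriv a \<in> wiener"
  shows "norm_F (E_mat a n) \<le> ennreal (real n * (real n - 1) / 2 *
    (wiener_norm (laurent_deriv a))\<^sup>2 * wiener_norm a ^ (n - 2))"
proof (induction n)
  case 0
  have "cmod (E_mat a 0 i j) = 0" for i j
    by (simp add: E_mat_def cmat_diff_def cmat_one_def toeplitz_def laurent_one_def)
  then show ?case
    by (simp add: norm_F_iterated)
next
  case (Suc n)
  let ?N = "wiener_norm a" and ?D = "wiener_norm (laurent_deriv a)"
  let ?B = "\<lambda>n. real n * (real n - 1) / 2 * ?D\<^sup>2 * ?N ^ (n - 2)"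
  \<comment> \<open>The factor \<open>real n - 1\<close> is negative only at \<open>n = 0\<close>,
    where the product is 0.\<close>
  have nonneg: "0 \<le> ?B n"
    by (cases n) (simp_all add: wiener_norm_nonneg)
  \<comment> \<open>The induction hypothesis supplies the finiteness that the recursion
    requires.\<close>
  have fin: "norm_F (E_mat a n) < \<infinity>"
    using Suc by (simp add: order_le_less_trans)
  have "norm_F (E_mat a (Suc n)) \<le> norm_F (cmat_mult (toeplitz a) (E_mat a n)) +
      norm_F (cmat_diff (cmat_mult (toeplitz a) (toeplitz (laurent_power a n)))
      (toeplitz (laurent_mult a (laurent_power a n))))"
    by (rule norm_F_add) (simp add: E_mat_Suc[OF assms(1) fin] norm_triangle_ineq)
  also have "\<dots> \<le> mass a * norm_F (E_mat a n) +
      mass (laurent_deriv a) * mass (laurent_deriv (laurent_power a n))"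
    by (intro add_mono norm_F_toeplitz_mult norm_F_toeplitz_defect wiener_laurent_power assms)
  also have "\<dots> \<le> ennreal ?N * ennreal (?B n) + ennreal ?D * ennreal (real n * ?D * ?N ^ (n - 1))"
    by (intro add_mono mult_mono Suc mass_laurent_deriv_power assms)
      (simp_all add: wiener_norm_mass assms)
  also have "\<dots> = ennreal (?N * ?B n + ?D * (real n * ?D * ?N ^ (n - 1)))"
    using nonneg by (subst ennreal_plus) (simp_all only: ennreal_mult'[OF wiener_norm_nonneg]
      mult_nonneg_nonneg wiener_norm_nonneg of_nat_0_le_iff zero_le_power)
  \<comment> \<open>For \<open>n \<ge> 2\<close> this is n(n-1)/2 + n = (n+1)n/2. The smaller cases,
    where exponents are truncated, are computed directly.\<close>
  also have "?N * ?B n + ?D * (real n * ?D * ?N ^ (n - 1)) = ?B (Suc n)"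
  proof (cases "n \<le> 1")
    case False
    then obtain m where "n = Suc (Suc m)"
      by (metis One_nat_def Suc_le_D not_less_eq_eq)
    then show ?thesis
      by (simp add: field_simps power2_eq_square)
  qed (auto simp: le_Suc_eq power2_eq_square)
  finally show ?case .
qed

subsection \<open>Operators on the sequence spaces\<close>

lemma one_le_ereal_cases:
  assumes "1 \<le> (p::ereal)"
  obtains (infinity) "p = \<infinity>" | (real) q where "p = ereal q" and "1 \<le> q"
  using assms by (cases p) auto

lemma lp_space_real: "lp_space (ereal q) = {x. (\<lambda>i. cmod (x i) powr q) summable_on UNIV}"
  and lp_norm_real: "lp_norm (ereal q) x = (\<Sum>\<^sub>\<infinity>i. cmod (x i) powr q) powr (1 / q)"
  by (simp_all add: lp_space_def lp_norm_def)

lemma lp_space_infinity: "lp_space \<infinity> = {x. bounded (range x)}"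
  and lp_norm_infinity: "lp_norm \<infinity> x = (SUP i. cmod (x i))"
  by (simp_all add: lp_space_def lp_norm_def)

lemma infsum_real_upper:
  fixes f :: "'a \<Rightarrow> real"
  assumes "f summable_on UNIV" and "\<And>i. 0 \<le> f i"
  shows "f i \<le> infsum f UNIV"
  using infsum_mono_neutral[of f "{i}" f UNIV] assms by simp

text \<open>The embedding of l1 into lp has norm at most 1: every \<open>r i\<close> is at most
  \<open>R\<close>, hence \<open>r i powr q\<close> is at most \<open>R powr (q - 1) * r i\<close>,
  and summation yields \<open>R powr q\<close>.\<close>

lemma lp_norm_le_dominated:
  fixes y :: cvec
  assumes "1 \<le> p" and "0 \<le> C" and "r summable_on UNIV" and "infsum r UNIV \<le> R"
    and r0: "\<And>i. 0 \<le> r i" and y: "\<And>i. cmod (y i) \<le> C * r i"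
  shows "y \<in> lp_space p" and "lp_norm p y \<le> C * R"
proof -
  have rR: "r i \<le> R" for i
    using infsum_real_upper[OF assms(3) r0] assms(4) order_trans by blast
  have R0: "0 \<le> R"
    using rR r0 order_trans by blast
  have yR: "cmod (y i) \<le> C * R" for i
    using y[of i] rR[of i] \<open>0 \<le> C\<close> by (meson mult_left_mono order_trans)
  have "y \<in> lp_space p \<and> lp_norm p y \<le> C * R"
    using \<open>1 \<le> p\<close>
  proof (cases rule: one_le_ereal_cases)
    case infinity
    show ?thesis
      using yR by (auto simp: infinity lp_space_infinity lp_norm_infinity bounded_iff intro!: cSUP_least)
  next
    case (real q)
    let ?g = "\<lambda>i. C powr q * R powr (q - 1) * r i"
    have le: "cmod (y i) powr q \<le> ?g i" for i
    proof (cases "r i = 0")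
      case False
      then have r: "0 < r i"
        using r0[of i] by simp
      have "cmod (y i) powr q \<le> (C * r i) powr q"
        using real y by (intro powr_mono2) auto
      also have "\<dots> = C powr q * (r i powr (q - 1) * r i)"
        using r \<open>0 \<le> C\<close> powr_add[of "r i" "q - 1" 1] by (simp add: powr_mult)
      also have "\<dots> \<le> C powr q * (R powr (q - 1) * r i)"
        using r rR real by (intro mult_left_mono mult_right_mono powr_mono2) auto
      finally show ?thesis
        by (simp add: mult.assoc)
    qed (use y[of i] in simp)
    have gs: "?g summable_on UNIV"
      using assms(3) by (rule summable_on_cmult_right)
    have ys: "(\<lambda>i. cmod (y i) powr q) summable_on UNIV"
      using gs le by (rule summable_on_comparison_test) simp
    have "(\<Sum>\<^sub>\<infinity>i. cmod (y i) powr q) \<le> infsum ?g UNIV"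
      using ys gs le by (rule infsum_mono)
    also have "\<dots> \<le> C powr q * R powr (q - 1) * R"
      unfolding infsum_cmult_right' by (intro mult_left_mono assms) simp
    also have "\<dots> = (C * R) powr q"
      using R0 \<open>0 \<le> C\<close> powr_add[of R "q - 1" 1] by (cases "R = 0") (simp_all add: powr_mult)
    finally have "lp_norm p y \<le> ((C * R) powr q) powr (1 / q)"
      unfolding real lp_norm_real using real by (intro powr_mono2 infsum_nonneg) auto
    also have "\<dots> = C * R"
      using R0 \<open>0 \<le> C\<close> real by (simp add: powr_powr)
    finally show ?thesis
      using ys by (simp add: real lp_space_real)
  qed
  then show "y \<in> lp_space p" "lp_norm p y \<le> C * R"
    by auto
qed

text \<open>Vectors in lp are thus bounded, so absolutely summable rows can act on them; it also
  serves to read off matrix entries from operator norms.\<close>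

lemma coord_le_lp_norm:
  assumes "1 \<le> p" and "x \<in> lp_space p"
  shows "cmod (x i) \<le> lp_norm p x"
  using \<open>1 \<le> p\<close>
proof (cases rule: one_le_ereal_cases)
  case infinity
  with assms(2) have "bdd_above (range (\<lambda>i. cmod (x i)))"
    by (auto simp: lp_space_infinity bounded_iff bdd_above_def)
  then show ?thesis
    unfolding infinity lp_norm_infinity by (intro cSUP_upper) auto
next
  case (real q)
  have "cmod (x i) = (cmod (x i) powr q) powr (1 / q)"
    using real by (simp add: powr_powr)
  also have "\<dots> \<le> lp_norm p x"
    unfolding real lp_norm_real using assms(2) real
    by (intro powr_mono2 infsum_real_upper) (auto simp: lp_space_real)
  finally show ?thesis .
qed

lemma lp_norm_nonneg: "1 \<le> p \<Longrightarrow> x \<in> lp_space p \<Longrightarrow> 0 \<le> lp_norm p x"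
  using coord_le_lp_norm[of p x 0] norm_ge_zero order_trans by blast

text \<open>The factor 4 avoids Minkowski's inequality; only boundedness of differences is needed.\<close>

lemma lp_norm_diff_le:
  assumes "1 \<le> p" and "u \<in> lp_space p" and "v \<in> lp_space p"
  shows "(\<lambda>i. u i - v i) \<in> lp_space p"
    and "lp_norm p (\<lambda>i. u i - v i) \<le> 4 * (lp_norm p u + lp_norm p v)"
proof -
  let ?S = "lp_norm p u + lp_norm p v"
  have S0: "0 \<le> lp_norm p u" "0 \<le> lp_norm p v"
    using assms by (auto intro: lp_norm_nonneg)
  have "(\<lambda>i. u i - v i) \<in> lp_space p \<and> lp_norm p (\<lambda>i. u i - v i) \<le> 4 * ?S"
    using \<open>1 \<le> p\<close>
  proof (cases rule: one_le_ereal_cases)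
    case infinity
    have "cmod (u i - v i) \<le> 4 * ?S" for i
      using norm_triangle_ineq4[of "u i" "v i"] coord_le_lp_norm[OF assms(1,2), of i]
        coord_le_lp_norm[OF assms(1,3), of i] S0 by simp
    then show ?thesis
      by (auto simp: infinity lp_space_infinity lp_norm_infinity bounded_iff intro!: cSUP_least)
  next
    case (real q)
    let ?g = "\<lambda>i. 2 powr q * (cmod (u i) powr q + cmod (v i) powr q)"
    have us: "(\<lambda>i. cmod (u i) powr q) summable_on UNIV" and vs: "(\<lambda>i. cmod (v i) powr q) summable_on UNIV"
      using assms by (auto simp: real lp_space_real)
    have gs: "?g summable_on UNIV"
      by (intro summable_on_cmult_right summable_on_add us vs)
    have le: "cmod (u i - v i) powr q \<le> ?g i" for i
    proof -
      let ?m = "max (cmod (u i)) (cmod (v i))"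
      have "cmod (u i - v i) powr q \<le> (2 * ?m) powr q"
        using norm_triangle_ineq4[of "u i" "v i"] real by (intro powr_mono2) auto
      also have "\<dots> = 2 powr q * ?m powr q"
        by (simp add: powr_mult)
      also have "\<dots> \<le> ?g i"
        by (intro mult_left_mono) (auto simp: max_def)
      finally show ?thesis .
    qed
    have ds: "(\<lambda>i. cmod (u i - v i) powr q) summable_on UNIV"
      using gs le by (rule summable_on_comparison_test) simp
    \<comment> \<open>To be applied to \<open>u\<close> and \<open>v\<close>, each of whose norms is
      at most \<open>?S\<close>.\<close>
    have root: "infsum (\<lambda>i. cmod (w i) powr q) UNIV \<le> ?S powr q"
      if "lp_norm p w \<le> ?S" for w
    proof -
      have "infsum (\<lambda>i. cmod (w i) powr q) UNIV = lp_norm p w powr q"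
        using real by (simp add: lp_norm_real powr_powr infsum_nonneg)
      also have "\<dots> \<le> ?S powr q"
        using that real by (intro powr_mono2) (auto simp: lp_norm_real)
      finally show ?thesis .
    qed
    have "(\<Sum>\<^sub>\<infinity>i. cmod (u i - v i) powr q) \<le> infsum ?g UNIV"
      using ds gs le by (rule infsum_mono)
    also have "\<dots> = 2 powr q * ((\<Sum>\<^sub>\<infinity>i. cmod (u i) powr q) + (\<Sum>\<^sub>\<infinity>i. cmod (v i) powr q))"
      by (simp add: infsum_cmult_right' infsum_add us vs)
    also have "\<dots> \<le> 2 powr q * (?S powr q + ?S powr q)"
      using S0 by (intro mult_left_mono add_mono root) auto
    also have "\<dots> = 2 powr q * (2 powr 1 * ?S powr q)"
      by simp
    \<comment> \<open>Since \<open>1 \<le> q\<close>, the factor 2 is at most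
      \<open>2 powr q\<close>; the two factors \<open>2 powr q\<close> combine to
      \<open>4 powr q\<close>.\<close>
    also have "\<dots> \<le> 2 powr q * (2 powr q * ?S powr q)"
      using real by (intro mult_left_mono mult_right_mono powr_mono) auto
    also have "\<dots> = (4 * ?S) powr q"
      using powr_mult[of 2 2 q] powr_mult[of 4 ?S q] by simp
    finally have "lp_norm p (\<lambda>i. u i - v i) \<le> ((4 * ?S) powr q) powr (1 / q)"
      unfolding real lp_norm_real using real by (intro powr_mono2 infsum_nonneg) auto
    also have "\<dots> = 4 * ?S"
      using S0 real by (simp add: powr_powr)
    finally show ?thesis
      using ds by (simp add: real lp_space_real)
  qed
  then show "(\<lambda>i. u i - v i) \<in> lp_space p" "lp_norm p (\<lambda>i. u i - v i) \<le> 4 * ?S"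
    by auto
qed

text \<open>Unit vectors lie in every unit ball, and a matrix sends them to its columns; they serve
  as test vectors for the operator norm.\<close>

lemma lp_basis:
  assumes "1 \<le> p"
  shows "(\<lambda>k. if k = j then 1 else 0) \<in> lp_space p"
    and "lp_norm p (\<lambda>k. if k = j then 1 else 0) \<le> 1"
proof -
  let ?r = "\<lambda>k. if k = j then 1 else (0::real)"
  have "?r summable_on UNIV"
    by (rule finite_nonzero_values_imp_summable_on) simp
  moreover have "infsum ?r UNIV \<le> 1"
    using infsum_cong_neutral[of UNIV "{j}" ?r ?r] by simp
  ultimately show "(\<lambda>k. if k = j then 1 else 0) \<in> lp_space p"
    and "lp_norm p (\<lambda>k. if k = j then 1 else 0) \<le> 1"
    using lp_norm_le_dominated[OF assms, of 1 ?r 1 "\<lambda>k. if k = j then 1 else 0"] by auto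
qed

lemma cmat_vec_basis: "cmat_vec A (\<lambda>k. if k = j then 1 else 0) i = A i j"
  using infsum_cong_neutral[of UNIV "{j}" "\<lambda>k. A i k * (if k = j then 1 else 0)"
      "\<lambda>k. A i k * (if k = j then 1 else 0)"]
  by (simp add: cmat_vec_def)

text \<open>The row sums \<open>r i\<close> of the moduli have total \<open>norm_F A\<close>, and
  each coordinate of the image is at most \<open>lp_norm p x * r i\<close>. Domination by an l1
  family then settles all \<open>p\<close> at once.\<close>

lemma norm_F_finite_action:
  assumes "1 \<le> p" and "norm_F A < \<infinity>" and "x \<in> lp_space p"
  shows "(\<lambda>j. A i j * x j) summable_on UNIV" and "cmat_vec A x \<in> lp_space p"
    and "lp_norm p (cmat_vec A x) \<le> enn2real (norm_F A) * lp_norm p x"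
proof -
  define r where "r i = (\<Sum>\<^sub>\<infinity>j. cmod (A i j))" for i
  have "infinite (UNIV :: (nat \<times> nat) set)"
    by (simp add: finite_prod)
  then have "norm_F A = mass (\<lambda>(i, j). A i j)"
    by (simp add: norm_F_def mass_def infsum_eq_nn_integral case_prod_unfold)
  with assms(2) have S: "(\<lambda>(i, j). cmod (A i j)) summable_on UNIV \<times> UNIV"
    using abs_summable_iff_mass[of "\<lambda>(i, j). A i j"] by (simp add: case_prod_unfold)
  have R: "norm_F A = ennreal (\<Sum>\<^sub>\<infinity>(i, j). cmod (A i j))"
    using S mass_eq_infsum[of "\<lambda>(i, j). A i j"] \<open>norm_F A = _\<close> \<open>infinite _\<close>
    by (simp add: case_prod_unfold)
  have row: "(\<lambda>j. cmod (A i j)) summable_on UNIV" for i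
    using S by (rule summable_on_SigmaD1) simp
  have rs: "r summable_on UNIV"
    unfolding r_def using summable_on_Sigma_banach[of "\<lambda>i j. cmod (A i j)" UNIV "\<lambda>_. UNIV"] S by simp
  have rR: "infsum r UNIV = enn2real (norm_F A)"
    unfolding r_def R using infsum_Sigma'_banach[of "\<lambda>i j. cmod (A i j)" UNIV "\<lambda>_. UNIV"] S
    by (simp add: infsum_nonneg case_prod_unfold)
  have dom: "(\<lambda>j. cmod (A i j * x j)) summable_on UNIV" for i
    using row coord_le_lp_norm[OF assms(1,3)] by (rule abs_summable_mult_bounded)
  then show "(\<lambda>j. A i j * x j) summable_on UNIV"
    by (rule abs_summable_summable)
  have "cmod (cmat_vec A x i) \<le> lp_norm p x * r i" for i
  proof -
    have "cmod (cmat_vec A x i) \<le> (\<Sum>\<^sub>\<infinity>j. cmod (A i j * x j))"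
      unfolding cmat_vec_def using dom by (rule norm_infsum_bound)
    also have "\<dots> \<le> (\<Sum>\<^sub>\<infinity>j. lp_norm p x * cmod (A i j))"
    proof (intro infsum_mono summable_on_cmult_right dom row)
      show "cmod (A i j * x j) \<le> lp_norm p x * cmod (A i j)" for j
        using coord_le_lp_norm[OF assms(1,3), of j]
        by (simp add: norm_mult mult.commute[of "cmod (A i j)"] mult_right_mono)
    qed
    finally show ?thesis
      by (simp add: r_def infsum_cmult_right')
  qed
  from lp_norm_le_dominated[OF assms(1) lp_norm_nonneg[OF assms(1,3)] rs eq_refl[OF rR] _ this]
  show "cmat_vec A x \<in> lp_space p"
    and "lp_norm p (cmat_vec A x) \<le> enn2real (norm_F A) * lp_norm p x"
    by (simp_all add: r_def infsum_nonneg mult.commute)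
qed

lemma norm_F_finite_lp_bounded: "1 \<le> p \<Longrightarrow> norm_F A < \<infinity> \<Longrightarrow> lp_bounded p A"
  unfolding lp_bounded_def using norm_F_finite_action by blast

lemma lp_opnorm_le_norm_F:
  assumes "1 \<le> p" and "norm_F A < \<infinity>"
  shows "lp_opnorm p A \<le> enn2real (norm_F A)"
  unfolding lp_opnorm_def
proof (rule cSUP_least)
  show "{x \<in> lp_space p. lp_norm p x \<le> 1} \<noteq> {}"
    using lp_basis[OF assms(1)] by blast
next
  fix x
  assume "x \<in> {x \<in> lp_space p. lp_norm p x \<le> 1}"
  then have "lp_norm p (cmat_vec A x) \<le> enn2real (norm_F A) * lp_norm p x"
      and "enn2real (norm_F A) * lp_norm p x \<le> enn2real (norm_F A) * 1"
    using norm_F_finite_action[OF assms] by (auto simp: mult_left_le)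
  then show "lp_norm p (cmat_vec A x) \<le> enn2real (norm_F A)"
    by simp
qed

section \<open>Convergence in operator norm and uniqueness of its limits\<close>

lemma has_sum_diff:
  fixes f g :: "'a \<Rightarrow> 'b::real_normed_vector"
  assumes "(f has_sum a) S" and "(g has_sum b) S"
  shows "((\<lambda>x. f x - g x) has_sum (a - b)) S"
  using has_sum_add[OF assms(1), of "\<lambda>x. - g x" "- b"] assms(2) by (simp add: has_sum_uminus)

text \<open>Convergence is stated through the operator norm of a difference, which is meaningful
  only once the difference is known to be bounded.\<close>

lemma lp_bounded_diff:
  assumes "1 \<le> p" and "lp_bounded p A" and "lp_bounded p B"
  shows "lp_bounded p (cmat_diff A B)"
proof -
  obtain C D where C: "\<And>x. x \<in> lp_space p \<Longrightarrow> lp_norm p (cmat_vec A x) \<le> C * lp_norm p x"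
    and D: "\<And>x. x \<in> lp_space p \<Longrightarrow> lp_norm p (cmat_vec B x) \<le> D * lp_norm p x"
    using assms unfolding lp_bounded_def by meson
  have hs: "((\<lambda>j. cmat_diff A B i j * x j) has_sum (cmat_vec A x i - cmat_vec B x i)) UNIV"
    if "x \<in> lp_space p" for x i
    using assms that unfolding lp_bounded_def cmat_diff_def cmat_vec_def left_diff_distrib
    by (intro has_sum_diff has_sum_infsum) auto
  then have s: "(\<lambda>j. cmat_diff A B i j * x j) summable_on UNIV" if "x \<in> lp_space p" for x i
    using that has_sum_imp_summable by blast
  have v: "cmat_vec (cmat_diff A B) x = (\<lambda>i. cmat_vec A x i - cmat_vec B x i)"
    if "x \<in> lp_space p" for x
    unfolding cmat_vec_def[of "cmat_diff A B"] using infsumI[OF hs[OF that]] by (rule ext)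
  have m: "cmat_vec (cmat_diff A B) x \<in> lp_space p"
    and le: "lp_norm p (cmat_vec (cmat_diff A B) x) \<le> 4 * (C + D) * lp_norm p x"
    if "x \<in> lp_space p" for x
    using that assms lp_norm_diff_le[OF assms(1), of "cmat_vec A x" "cmat_vec B x"] C[OF that] D[OF that]
    by (auto simp: v lp_bounded_def algebra_simps)
  show ?thesis
    unfolding lp_bounded_def using s m le by blast
qed

text \<open>The entry is a coordinate of the image of a unit vector. Boundedness makes the supremum
  over the unit ball a genuine upper bound.\<close>

lemma entry_le_lp_opnorm:
  assumes "1 \<le> p" and "lp_bounded p A"
  shows "cmod (A i j) \<le> lp_opnorm p A"
proof -
  let ?e = "\<lambda>k. if k = j then 1 else 0"
  obtain C where C: "\<And>x. x \<in> lp_space p \<Longrightarrow> lp_norm p (cmat_vec A x) \<le> C * lp_norm p x"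
    using assms unfolding lp_bounded_def by meson
  \<comment> \<open>The constant \<open>C\<close> may be negative, hence the absolute value.\<close>
  have "lp_norm p (cmat_vec A x) \<le> \<bar>C\<bar>" if "x \<in> lp_space p" "lp_norm p x \<le> 1" for x
  proof -
    have "C * lp_norm p x \<le> \<bar>C\<bar> * lp_norm p x"
      using that by (intro mult_right_mono lp_norm_nonneg assms) auto
    also have "\<dots> \<le> \<bar>C\<bar> * 1"
      using that by (intro mult_left_mono) auto
    finally show ?thesis
      using C[OF that(1)] by simp
  qed
  then have bdd: "bdd_above ((\<lambda>x. lp_norm p (cmat_vec A x)) ` {x \<in> lp_space p. lp_norm p x \<le> 1})"
    by (auto intro!: bdd_aboveI2)
  have "cmat_vec A ?e \<in> lp_space p"
    using assms lp_basis[OF assms(1)] by (auto simp: lp_bounded_def)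
  then have "cmod (A i j) \<le> lp_norm p (cmat_vec A ?e)"
    using coord_le_lp_norm[OF assms(1), of "cmat_vec A ?e" i] by (simp add: cmat_vec_basis)
  also have "\<dots> \<le> lp_opnorm p A"
    unfolding lp_opnorm_def using lp_basis[OF assms(1)] by (intro cSUP_upper bdd) simp
  finally show ?thesis .
qed

lemma lp_op_tendsto_entry:
  assumes "1 \<le> p" and "lp_op_tendsto p X A"
  shows "(\<lambda>k. X k i j) \<longlonglongrightarrow> A i j"
proof (rule LIM_zero_cancel, rule Lim_null_comparison)
  show "\<forall>\<^sub>F k in sequentially. norm (X k i j - A i j) \<le> lp_opnorm p (cmat_diff (X k) A)"
    using assms entry_le_lp_opnorm[OF assms(1) lp_bounded_diff[OF assms(1)], of _ A i j]
    by (simp add: lp_op_tendsto_def cmat_diff_def)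
  show "(\<lambda>k. lp_opnorm p (cmat_diff (X k) A)) \<longlonglongrightarrow> 0"
    using assms by (simp add: lp_op_tendsto_def)
qed

lemma norm_F_tendsto_imp_lp_op_tendsto:
  assumes "1 \<le> p" and "\<And>k. norm_F (X k) < \<infinity>" and "norm_F A < \<infinity>"
    and "\<And>k. norm_F (cmat_diff (X k) A) \<le> ennreal (\<epsilon> k)" and "\<epsilon> \<longlonglongrightarrow> 0" and "\<And>k. 0 \<le> \<epsilon> k"
  shows "lp_op_tendsto p X A"
  unfolding lp_op_tendsto_def
proof (intro conjI allI norm_F_finite_lp_bounded assms)
  have fin: "norm_F (cmat_diff (X k) A) < \<infinity>" for k
    using assms(4)[of k] by (simp add: order_le_less_trans)
  have "lp_opnorm p (cmat_diff (X k) A) \<le> \<epsilon> k" for k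
    using lp_opnorm_le_norm_F[OF assms(1) fin] enn2real_mono[OF assms(4)] assms(6)
    by (metis enn2real_ennreal ennreal_less_top order_trans)
  \<comment> \<open>The modulus of any entry is a lower bound.\<close>
  moreover have "0 \<le> lp_opnorm p (cmat_diff (X k) A)" for k
    using entry_le_lp_opnorm[OF assms(1) norm_F_finite_lp_bounded[OF assms(1) fin]] norm_ge_zero order_trans
    by blast
  ultimately show "(\<lambda>k. lp_opnorm p (cmat_diff (X k) A)) \<longlonglongrightarrow> 0"
    by (intro tendsto_sandwich[OF _ _ tendsto_const assms(5)]) auto
qed

subsection \<open>Series of matrices\<close>

lemma cmod_suminf_le_ennreal:
  fixes f :: "nat \<Rightarrow> complex"
  shows "ennreal (cmod (suminf f)) \<le> (\<Sum>n. ennreal (cmod (f n)))"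
proof (cases "(\<Sum>n. ennreal (cmod (f n))) = top")
  case False
  then have s: "summable (\<lambda>n. cmod (f n))"
    by (intro summable_suminf_not_top) auto
  then have "ennreal (cmod (suminf f)) \<le> ennreal (\<Sum>n. cmod (f n))"
    by (intro ennreal_leI summable_norm)
  also have "\<dots> = (\<Sum>n. ennreal (cmod (f n)))"
    using s by (intro suminf_ennreal_eq[symmetric]) (auto simp: summable_sums)
  finally show ?thesis .
qed simp

lemma norm_F_suminf:
  "norm_F (\<lambda>i j. \<Sum>n. G n i j) \<le> (\<Sum>n. norm_F (G n))"
proof -
  have "norm_F (\<lambda>i j. \<Sum>n. G n i j) \<le>
      (\<integral>\<^sup>+i. \<integral>\<^sup>+j. (\<Sum>n. ennreal (cmod (G n i j))) \<partial>count_space UNIV \<partial>count_space UNIV)"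
    unfolding norm_F_iterated by (intro nn_integral_mono cmod_suminf_le_ennreal)
  also have "\<dots> = (\<Sum>n. norm_F (G n))"
    by (simp add: norm_F_iterated nn_integral_suminf)
  finally show ?thesis .
qed

lemma norm_F_scale: "norm_F (\<lambda>i j. c * S i j) = ennreal (cmod c) * norm_F S"
  by (simp add: norm_F_iterated norm_mult ennreal_mult nn_integral_cmult)

text \<open>A Weierstrass M-test in \<open>norm_F\<close>: the limit is formed entrywise, and the
  remainder is bounded by the tail of the majorant \<open>c\<close>.\<close>

lemma norm_F_series:
  fixes G :: "nat \<Rightarrow> cmat"
  assumes le: "\<And>n. norm_F (G n) \<le> ennreal (c n)" and c0: "\<And>n. 0 \<le> c n" and c: "c sums C"
  defines "S \<equiv> \<lambda>i j. \<Sum>n. G n i j"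
  shows "norm_F S \<le> ennreal C"
    and "norm_F (cmat_diff (\<lambda>i j. \<Sum>n\<le>k. G n i j) S) \<le> ennreal (C - (\<Sum>n\<le>k. c n))"
proof -
  \<comment> \<open>One tail estimate gives both claims, with \<open>m = 0\<close> and with
    \<open>m = Suc k\<close>.\<close>
  have bound: "norm_F (\<lambda>i j. \<Sum>n. G (n + m) i j) \<le> ennreal (C - (\<Sum>n<m. c n))" for m
  proof -
    have "norm_F (\<lambda>i j. \<Sum>n. G (n + m) i j) \<le> (\<Sum>n. norm_F (G (n + m)))"
      by (rule norm_F_suminf)
    also have "\<dots> \<le> (\<Sum>n. ennreal (c (n + m)))"
      by (intro suminf_le le) auto
    also have "\<dots> = ennreal (C - (\<Sum>n<m. c n))"
      using sums_split_initial_segment[OF c, of m] c0 by (intro suminf_ennreal_eq) auto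
    finally show ?thesis .
  qed
  \<comment> \<open>The majorant also bounds each entry, so the entrywise series converge and an
    initial segment can be split off.\<close>
  have "ennreal (cmod (G n i j)) \<le> ennreal (c n)" for n i j
    using entry_le_norm_F le order_trans by blast
  then have "cmod (G n i j) \<le> c n" for n i j
    using c0 by simp
  then have sm: "summable (\<lambda>n. G n i j)" for i j
    using c by (intro summable_comparison_test'[OF sums_summable]) auto
  show "norm_F S \<le> ennreal C"
    using bound[of 0] by (simp add: S_def)
  have "norm_F (cmat_diff (\<lambda>i j. \<Sum>n\<le>k. G n i j) S) = norm_F (\<lambda>i j. \<Sum>n. G (n + Suc k) i j)"
  proof -
    have "cmod ((\<Sum>n\<le>k. G n i j) - S i j) = cmod (\<Sum>n. G (n + Suc k) i j)" for i j
      using suminf_split_initial_segment[OF sm, of i j "Suc k"]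
      by (simp only: S_def lessThan_Suc_atMost) (simp add: norm_minus_commute)
    then show ?thesis
      by (simp only: norm_F_iterated cmat_diff_def)
  qed
  then show "norm_F (cmat_diff (\<lambda>i j. \<Sum>n\<le>k. G n i j) S) \<le> ennreal (C - (\<Sum>n\<le>k. c n))"
    using bound[of "Suc k"] by (simp only: lessThan_Suc_atMost)
qed

lemma norm_F_sum_le: "norm_F (\<lambda>i j. \<Sum>n\<le>k. G n i j) \<le> (\<Sum>n\<le>(k::nat). norm_F (G n))"
proof (induction k)
  case (Suc k)
  have "norm_F (\<lambda>i j. \<Sum>n\<le>Suc k. G n i j) \<le> norm_F (\<lambda>i j. \<Sum>n\<le>k. G n i j) + norm_F (G (Suc k))"
    by (rule norm_F_add) (simp add: norm_triangle_ineq)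
  also have "\<dots> \<le> (\<Sum>n\<le>Suc k. norm_F (G n))"
    using Suc by (simp add: add_right_mono)
  finally show ?case .
qed simp

text \<open>Since n(n-1)/n! = 1/(n-2)! for \<open>n \<ge> 2\<close> and the terms at 0 and 1 vanish,
  this is the exponential series shifted by two places.\<close>

lemma E_bound_over_fact_sums:
  fixes D N :: real
  shows "(\<lambda>n. 1 / fact n * (real n * (real n - 1) / 2 * D\<^sup>2 * N ^ (n - 2))) sums (1 / 2 * D\<^sup>2 * exp N)"
    (is "?f sums _")
proof -
  have "(\<lambda>n. 1 / 2 * D\<^sup>2 * (N ^ n /\<^sub>R fact n)) sums (1 / 2 * D\<^sup>2 * exp N)"
    by (intro sums_mult exp_converges)
  moreover have "1 / 2 * D\<^sup>2 * (N ^ n /\<^sub>R fact n) = ?f (n + 2)" for n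
  proof -
    define K where "K = real (n + 2) * (real (n + 2) - 1)"
    have "K \<noteq> 0"
      unfolding K_def mult_eq_0_iff by linarith
    moreover have "fact (n + 2) = K * fact n"
      by (simp add: K_def algebra_simps)
    ultimately show ?thesis
      by (simp only: add_diff_cancel_right' K_def[symmetric]) (simp add: field_simps)
  qed
  ultimately have "(\<lambda>n. ?f (n + 2)) sums (1 / 2 * D\<^sup>2 * exp N)"
    by simp
  then show ?thesis
    by (subst (asm) sums_iff_shift) (simp add: numeral_2_eq_2)
qed

theorem theorem3p3:
  fixes a :: "int \<Rightarrow> complex"
  assumes "a \<in> wiener" and "laurent_deriv a \<in> wiener"
  shows "(\<forall>i. norm_F (E_mat a i) \<le>
            ennreal (real i * (real i - 1) / 2 * (wiener_norm (laurent_deriv a))\<^sup>2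
                       * wiener_norm a ^ (i - 2)))
       \<and> (\<exists>F. (\<forall>p::ereal. 1 \<le> p \<longrightarrow> (\<forall>G. lp_op_tendsto p (F_mat a) G \<longleftrightarrow> G = F))
            \<and> norm_F F \<le>
                ennreal (1 / 2 * (wiener_norm (laurent_deriv a))\<^sup>2 * exp (wiener_norm a)))"
proof -
  let ?N = "wiener_norm a" and ?D = "wiener_norm (laurent_deriv a)"
  define c where "c n = 1 / fact n * (real n * (real n - 1) / 2 * ?D\<^sup>2 * ?N ^ (n - 2))" for n
  define G where "G n = (\<lambda>i j. 1 / fact n * E_mat a n i j)" for n
  \<comment> \<open>The entrywise sum does not depend on \<open>p\<close>, so a single matrix is the
    limit for all \<open>p\<close>.\<close>
  define F where "F = (\<lambda>i j. \<Sum>n. G n i j)"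
  let ?C = "1 / 2 * ?D\<^sup>2 * exp ?N"
  have c0: "0 \<le> c n" for n
    unfolding c_def by (cases n) (simp_all add: wiener_norm_nonneg)
  have csum: "c sums ?C"
    using E_bound_over_fact_sums[of ?D ?N] by (simp only: c_def[abs_def])
  have Gc: "norm_F (G n) \<le> ennreal (c n)" for n
  proof -
    have "norm_F (G n) = ennreal (1 / fact n) * norm_F (E_mat a n)"
      unfolding G_def norm_F_scale by (simp add: norm_divide)
    also have "\<dots> \<le> ennreal (1 / fact n) * ennreal (real n * (real n - 1) / 2 * ?D\<^sup>2 * ?N ^ (n - 2))"
      by (intro mult_left_mono norm_F_E_mat assms) simp
    also have "\<dots> = ennreal (c n)"
      unfolding c_def by (rule ennreal_mult'[symmetric]) simp
    finally show ?thesis .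
  qed
  note series = norm_F_series[OF Gc c0 csum, folded F_def]
  have FG: "F_mat a k = (\<lambda>i j. \<Sum>n\<le>k. G n i j)" for k
    by (simp add: fun_eq_iff F_mat_def G_def)
  have "norm_F (F_mat a k) < \<infinity>" for k
  proof -
    have "norm_F (F_mat a k) \<le> (\<Sum>n\<le>k. norm_F (G n))"
      unfolding FG by (rule norm_F_sum_le)
    also have "\<dots> \<le> (\<Sum>n\<le>k. ennreal (c n))"
      by (intro sum_mono Gc)
    also have "\<dots> < \<infinity>"
      by simp
    finally show ?thesis .
  qed
  moreover have "norm_F F < \<infinity>"
    using series(1) by (simp add: order_le_less_trans)
  moreover have "(\<lambda>k. ?C - (\<Sum>n\<le>k. c n)) \<longlonglongrightarrow> 0"
    using tendsto_diff[OF tendsto_const[of ?C] csum[unfolded sums_def_le]] by simp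
  \<comment> \<open>The tails must be nonnegative, because \<open>ennreal\<close> maps negative
    reals to 0.\<close>
  moreover have "0 \<le> ?C - (\<Sum>n\<le>k. c n)" for k
    using sum_le_suminf[OF sums_summable[OF csum], of "{..k}"] c0 csum by (simp add: sums_iff)
  ultimately have conv: "lp_op_tendsto p (F_mat a) F" if "1 \<le> p" for p
    using that series(2) by (intro norm_F_tendsto_imp_lp_op_tendsto[where \<epsilon> = "\<lambda>k. ?C - (\<Sum>n\<le>k. c n)"])
      (simp_all only: FG)
  \<comment> \<open>Both limits have the same entries, namely the limits of the entries of
    \<open>F_mat a k\<close>.\<close>
  have "H = F" if "1 \<le> p" and "lp_op_tendsto p (F_mat a) H" for p H
    using LIMSEQ_unique lp_op_tendsto_entry[OF that] lp_op_tendsto_entry[OF that(1) conv[OF that(1)]]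
    by (metis ext)
  with conv series(1) norm_F_E_mat[OF assms] show ?thesis
    by blast
qed

end
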